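(* Let $\tilde{f} = \tilde{f}(x,x',h)$ be a consistent approximation of $f(x)$ and, for each $m = 1,\dots,M$, let $\tilde{i}^m = \tilde{i}^m(x,x',h)$ be a consistent approximation of $i^m(x)$ and let $\bar{i}^m = \bar{i}^m(x,x')$ be a discrete gradient of $I_m$. Define $$A = [\tilde{i}^1 \cdots \tilde{i}^M] \in \mathbb{R}^{d \times M}, \qquad B = [\bar{i}^1 \cdots \bar{i}^M] \in \mathbb{R}^{d \times M}, \qquad \widetilde{S} = \frac{1}{\det(B^T A)}\, \tilde{f} \wedge \tilde{i}^1 \wedge \cdots \wedge \tilde{i}^M,$$ all depending on $(x,x',h)$. Consider, for given $x \in \mathbb{R}^d$ and $h \in [0,\infty)$: (DG) the discrete gradient method: find $x' \in \mathbb{R}^d$ such that $$\frac{x'_j - x_j}{h} = \widetilde{S}_{j j_1 j_2 \cdots j_M}\, \bar{i}^1_{j_1} \cdots \bar{i}^M_{j_M} \quad \text{for each } j = 1,\dots,d$$ (summation over repeated indices $j_1,\dots,j_M \in \{1,\dots,d\}$); (LP) the linear projection method, defined by either of the expressions: find $x' \in \mathbb{R}^d$ and $\lambda \in \mathbb{R}^M$ such that $x' = x + h\tilde{f}(x,x',h) + A\lambda$ and $I_m(x') = I_m(x)$ for all $m = 1,\dots,M$; or find $x' \in \mathbb{R}^d$ such that $x' = x + h P \tilde{f}(x,x',h)$, where $P = \mathrm{Id} - A(B^T A)^{-1} B^T$. Assume that, for sufficiently small $h$, 1. the discrete gradient method and the linear projection method have uniquely defined $x' \in \mathbb{R}^d$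 and $\lambda \in \mathbb{R}^M$; and that, at the solutions $x'$ of the methods, 2. $\{\tilde{i}^1,\dots,\tilde{i}^M\}$ and $\{\bar{i}^1,\dots,\bar{i}^M\}$ are linearly independent sets; 3. $\tilde{\mathcal{S}}$ and $\bar{\mathcal{S}}^\perp$ are complementary subspaces of $\mathbb{R}^d$, where $\tilde{\mathcal{S}} = \operatorname{span}\{\tilde{i}^1,\dots,\tilde{i}^M\}$ and $\bar{\mathcal{S}} = \operatorname{span}\{\bar{i}^1,\dots,\bar{i}^M\}$. Then the discrete gradient method (DG) is equivalent to the linear projection method (LP), i.e. for such $x$ and $h$ they yield the same $x'$.
   Context: Setting: $d, M \in \mathbb{N}$; $f : \mathbb{R}^d \to \mathbb{R}^d$ is locally Lipschitz continuous; the ODE $\dot{x} = f(x)$ has $M$ first integrals $I_1,\dots,I_M : \mathbb{R}^d \to \mathbb{R}$ (each constant along solutions), and $i^m := \nabla I_m$ (the superscript is an index; $i^m_j$ is the $j$-th component). A discrete gradient of $I_m$ is a continuous map $\bar{i}^m : \mathbb{R}^d \times \mathbb{R}^d \to \mathbb{R}^d$ with $\bar{i}^m(x,x') \cdot (x'-x) = I_m(x') - I_m(x)$ and $\bar{i}^m(x,x) = i^m(x)$ for all $x,x' \in \mathbb{R}^d$. For $\varphi : \mathbb{R}^d \to \mathbb{R}^d$, a map $\tilde{\varphi} : \mathbb{R}^d \times \mathbb{R}^d \times [0,\infty) \to \mathbb{R}^d$ is a consistent approximation of $\varphi$ if $\tilde{\varphi}(x,x,0) = \varphi(x)$ for all $x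 \in \mathbb{R}^d$. Wedge product convention: for $u^1,\dots,u^K \in \mathbb{R}^d$, $(u^1 \wedge \cdots \wedge u^K)_{j_1 \cdots j_K}$ is the determinant of the $K \times K$ matrix whose $(a,b)$ entry is $u^b_{j_a}$ (no $1/K!$ factor). $\mathrm{Id}$ is the $d \times d$ identity matrix; $\perp$ is the Euclidean orthogonal complement. Complementary subspaces: $\tilde{\mathcal{S}} + \bar{\mathcal{S}}^\perp = \mathbb{R}^d$ and $\tilde{\mathcal{S}} \cap \bar{\mathcal{S}}^\perp = \{0\}$; under conditions 2 and 3, $B^T A$ is invertible. At $h = 0$ the (DG) equation is understood after multiplication by $h$. *)

theory Defs
  imports "HOL-Analysis.Analysis"
begin

definition locally_Lipschitz :: "('a::metric_space \<Rightarrow> 'b::metric_space) \<Rightarrow> bool" where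
  "locally_Lipschitz f \<longleftrightarrow> local_lipschitz (UNIV :: real set) UNIV (\<lambda>_. f)"

definition ode_solution_on ::
  "('a::real_normed_vector \<Rightarrow> 'a) \<Rightarrow> real set \<Rightarrow> (real \<Rightarrow> 'a) \<Rightarrow> bool" where
  "ode_solution_on f T c \<longleftrightarrow>
     is_interval T \<and> (\<forall>t\<in>T. (c has_vector_derivative f (c t)) (at t within T))"

definition first_integral ::
  "('a::real_normed_vector \<Rightarrow> 'a) \<Rightarrow> ('a \<Rightarrow> real) \<Rightarrow> bool" where
  "first_integral f I \<longleftrightarrow>
     (\<forall>T c. ode_solution_on f T c \<longrightarrow> (\<forall>s\<in>T. \<forall>t\<in>T. I (c s) = I (c t)))"

text \<open>The argument \<open>i\<close> is the gradient of \<open>I\<close>.\<close>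

definition discrete_gradient ::
  "('a::real_inner \<Rightarrow> real) \<Rightarrow> ('a \<Rightarrow> 'a) \<Rightarrow> ('a \<Rightarrow> 'a \<Rightarrow> 'a) \<Rightarrow> bool" where
  "discrete_gradient I i ib \<longleftrightarrow>
     continuous_on UNIV (\<lambda>(x, x'). ib x x') \<and>
     (\<forall>x x'. ib x x' \<bullet> (x' - x) = I x' - I x) \<and>
     (\<forall>x. ib x x = i x)"

text \<open>The third argument of an approximation is a step size in $[0,\infty)$; its values at
  negative reals are never used below.\<close>

definition consistent_approx ::
  "('a \<Rightarrow> 'a) \<Rightarrow> ('a \<Rightarrow> 'a \<Rightarrow> real \<Rightarrow> 'a) \<Rightarrow> bool" where
  "consistent_approx \<phi> \<phi>t \<longleftrightarrow> (\<forall>x. \<phi>t x x 0 = \<phi> x)"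

text \<open>Linear independence of a family: repeated members count as dependent.\<close>

definition lin_indep_family :: "('m \<Rightarrow> 'a::real_vector) \<Rightarrow> bool" where
  "lin_indep_family u \<longleftrightarrow> inj u \<and> independent (range u)"

definition complementary :: "'a::real_vector set \<Rightarrow> 'a set \<Rightarrow> bool" where
  "complementary U V \<longleftrightarrow> {u + v | u v. u \<in> U \<and> v \<in> V} = UNIV \<and> U \<inter> V = {0}"

definition columns_matrix :: "('m \<Rightarrow> real ^ 'd) \<Rightarrow> real ^ 'm ^ 'd" where
  "columns_matrix u = (\<chi> j m. u m $ j)"

text \<open>Components of a wedge product without factor $1/K!$. The factors and the index slots are
  labelled by the same finite type \<open>'k\<close> with $K$ elements; the determinant does not change when
  both are enumerated in another common order, so no order on \<open>'k\<close> has to be chosen.\<close>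

definition wedge :: "('k::finite \<Rightarrow> real ^ 'd) \<Rightarrow> ('k \<Rightarrow> 'd) \<Rightarrow> real" where
  "wedge u j = det (\<chi> a b. u b $ j a)"

text \<open>In the following, \<open>ft\<close>, \<open>it\<close> and \<open>ib\<close> are vectors, namely the values at some
  \<open>(x, x', h)\<close> of the approximations of \<open>f\<close> and of the gradients and of the discrete gradients.
  The $M+1$ factors and slots of the wedge product are labelled by \<open>'m option\<close>: \<open>None\<close> is the first
  one, belonging to \<open>ft\<close> and the free index, and \<open>Some m\<close> belongs to \<open>it m\<close> and the \<open>m\<close>-th
  summation index.\<close>

definition gram :: "('m \<Rightarrow> real ^ 'd) \<Rightarrow> ('m \<Rightarrow> real ^ 'd) \<Rightarrow> real ^ 'm ^ 'm" where
  "gram it ib = transpose (columns_matrix ib) ** columns_matrix it"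

definition S_tensor ::
  "real ^ 'd \<Rightarrow> ('m::finite \<Rightarrow> real ^ 'd) \<Rightarrow> ('m \<Rightarrow> real ^ 'd) \<Rightarrow> ('m option \<Rightarrow> 'd) \<Rightarrow> real" where
  "S_tensor ft it ib j = 1 / det (gram it ib) * wedge (case_option ft it) j"

definition projector :: "('m::finite \<Rightarrow> real ^ 'd) \<Rightarrow> ('m \<Rightarrow> real ^ 'd) \<Rightarrow> real ^ 'd ^ 'd" where
  "projector it ib =
     mat 1 - columns_matrix it ** matrix_inv (gram it ib) ** transpose (columns_matrix ib)"

text \<open>The discrete gradient equation is multiplied by \<open>h\<close>, which is how it is read at \<open>h = 0\<close>.
  A solution is required to make the coefficients well-defined: the first conjunct in
  \<open>DG_solution\<close> and in \<open>LP_proj_solution\<close> excludes solutions that would only come from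
  \<open>1 / 0 = 0\<close> and from the arbitrary value of \<open>matrix_inv\<close> at a singular matrix.\<close>

definition DG_solution ::
  "(real ^ 'd \<Rightarrow> real ^ 'd \<Rightarrow> real \<Rightarrow> real ^ 'd) \<Rightarrow>
   ('m::finite \<Rightarrow> real ^ 'd \<Rightarrow> real ^ 'd \<Rightarrow> real \<Rightarrow> real ^ 'd) \<Rightarrow>
   ('m \<Rightarrow> real ^ 'd \<Rightarrow> real ^ 'd \<Rightarrow> real ^ 'd) \<Rightarrow>
   real ^ 'd \<Rightarrow> real \<Rightarrow> real ^ 'd \<Rightarrow> bool" where
  "DG_solution ft it ib x h x' \<longleftrightarrow>
     det (gram (\<lambda>m. it m x x' h) (\<lambda>m. ib m x x')) \<noteq> 0 \<and>
     (\<forall>j. x' $ j - x $ j =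
        h * (\<Sum>js\<in>UNIV. S_tensor (ft x x' h) (\<lambda>m. it m x x' h) (\<lambda>m. ib m x x') (case_option j js)
               * (\<Prod>m\<in>UNIV. ib m x x' $ js m)))"

definition LP_solution ::
  "(real ^ 'd \<Rightarrow> real ^ 'd \<Rightarrow> real \<Rightarrow> real ^ 'd) \<Rightarrow>
   ('m::finite \<Rightarrow> real ^ 'd \<Rightarrow> real ^ 'd \<Rightarrow> real \<Rightarrow> real ^ 'd) \<Rightarrow>
   ('m \<Rightarrow> real ^ 'd \<Rightarrow> real) \<Rightarrow>
   real ^ 'd \<Rightarrow> real \<Rightarrow> real ^ 'd \<Rightarrow> real ^ 'm \<Rightarrow> bool" where
  "LP_solution ft it I x h x' lam \<longleftrightarrow>
     x' = x + h *\<^sub>R ft x x' h + columns_matrix (\<lambda>m. it m x x' h) *v lam \<and>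
     (\<forall>m. I m x' = I m x)"

definition LP_proj_solution ::
  "(real ^ 'd \<Rightarrow> real ^ 'd \<Rightarrow> real \<Rightarrow> real ^ 'd) \<Rightarrow>
   ('m::finite \<Rightarrow> real ^ 'd \<Rightarrow> real ^ 'd \<Rightarrow> real \<Rightarrow> real ^ 'd) \<Rightarrow>
   ('m \<Rightarrow> real ^ 'd \<Rightarrow> real ^ 'd \<Rightarrow> real ^ 'd) \<Rightarrow>
   real ^ 'd \<Rightarrow> real \<Rightarrow> real ^ 'd \<Rightarrow> bool" where
  "LP_proj_solution ft it ib x h x' \<longleftrightarrow>
     invertible (gram (\<lambda>m. it m x x' h) (\<lambda>m. ib m x x')) \<and>
     x' = x + h *\<^sub>R (projector (\<lambda>m. it m x x' h) (\<lambda>m. ib m x x') *v ft x x' h)"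

end

theory Submission
  imports Defs
begin

text \<open>Contracting the wedge product with the discrete gradients replaces, in the determinant, the
  rows of the summation indices by inner products, so it yields the determinant of \<open>gram\<close> bordered
  by a row of components of \<open>ft\<close>, \<open>it\<close> and by the column \<open>B\<^sup>T ft\<close>. A column operation turns this
  determinant into \<open>det (gram) * (P ft)\<^sub>j\<close>, so (DG) is the projected form of (LP). In the multiplier
  form of (LP), the defining property of discrete gradients turns conservation of the integrals into
  \<open>B\<^sup>T (x' - x) = 0\<close>, a linear system for the multipliers with matrix \<open>gram\<close>.\<close>

declare transpose_matrix_vector [simp del]

section \<open>Determinants with rows and columns labelled by an option type\<close>

text \<open>Expansion along column \<open>None\<close>: only permutations that fix
  \<open>None\<close> contribute to the Leibniz sum, and these are the permutations of
  \<open>'m\<close> carried over by \<open>Some\<close>, with the same sign.\<close>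

lemma det_option_corner:
  fixes C :: "'a::comm_ring_1 ^ 'm::finite option ^ 'm option"
  assumes "\<And>m. C $ Some m $ None = 0"
  shows "det C = C $ None $ None * det (\<chi> a b. C $ Some a $ Some b)"
proof -
  let ?t = "\<lambda>p. of_int (sign p) * (\<Prod>a\<in>UNIV. C $ a $ p a)"
  let ?F = "map_permutation (UNIV :: 'm set) Some"
  let ?R = "{p. p permutes range (Some :: 'm \<Rightarrow> 'm option)}"
  have bij: "bij_betw Some UNIV (range (Some :: 'm \<Rightarrow> 'm option))"
    by (simp add: bij_betw_def)
  have bijF: "bij_betw ?F {q. q permutes UNIV} ?R"
  proof -
    have "?F = (\<lambda>q y. if y \<in> range Some then Some (q (inv_into UNIV Some y)) else y)"
      by (auto simp: map_permutation_def restrict_id_def fun_eq_iff)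
    with bij_betw_permutations[OF bij] show ?thesis
      by simp
  qed
  have t: "?t (?F q) = C $ None $ None *
      (of_int (sign q) * (\<Prod>a\<in>UNIV. C $ Some a $ Some (q a)))" if "q permutes UNIV" for q
  proof -
    have "?F q None = None"
      by (auto simp: map_permutation_def restrict_id_def)
    then show ?thesis
      using that
      by (simp add: UNIV_option_conv prod.reindex map_permutation_apply sign_map_permutation
          algebra_simps)
  qed
  have "det C = sum ?t {p. p permutes UNIV}"
    by (simp add: det_def)
  also have "\<dots> = sum ?t ?R"
  proof (rule sum.mono_neutral_right)
    show "?R \<subseteq> {p. p permutes UNIV}"
      by (auto intro: permutes_subset)
    show "\<forall>p \<in> {p. p permutes UNIV} - ?R. ?t p = 0"
    proof
      fix p :: "'m option \<Rightarrow> 'm option"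
      assume "p \<in> {p. p permutes UNIV} - ?R"
      then have p: "p permutes UNIV" and nR: "\<not> p permutes range Some"
        by auto
      \<comment> \<open>A permutation outside \<open>?R\<close> moves \<open>None\<close>, so by
        surjectivity it sends some \<open>Some m\<close> to \<open>None\<close>; the corresponding
        factor is one of the vanishing entries.\<close>
      have "p None \<noteq> None"
      proof
        assume "p None = None"
        then have "p permutes range Some"
          by (intro permutes_superset[OF p]) (auto simp: UNIV_option_conv)
        with nR show False ..
      qed
      moreover obtain a where a: "p a = None"
        using permutes_surj[OF p] unfolding surj_def by metis
      ultimately obtain m where "p (Some m) = None"
        by (cases a) auto
      then have "C $ Some m $ p (Some m) = 0"
        by (simp add: assms)
      then have "(\<Prod>a\<in>UNIV. C $ a $ p a) = 0"
        by (intro prod_zero) (auto intro: bexI[of _ "Some m"])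
      then show "?t p = 0"
        by simp
    qed
  qed simp
  also have "\<dots> = (\<Sum>q | q permutes UNIV. ?t (?F q))"
    using sum.reindex_bij_betw[OF bijF, of ?t] by simp
  also have "\<dots> = C $ None $ None * det (\<chi> a b. C $ Some a $ Some b)"
    by (simp add: t det_def sum_distrib_left)
  finally show ?thesis .
qed

text \<open>By hypothesis, column \<open>None\<close> agrees below its top entry with the
  combination of the other columns with coefficients \<open>c\<close>. Subtracting that combination
  clears the column below the corner.\<close>

lemma det_option_bordered:
  fixes N :: "'a::field ^ 'm::finite option ^ 'm option"
  assumes "\<And>m. (\<Sum>b\<in>UNIV. N $ Some m $ Some b * c b) = N $ Some m $ None"
  shows "det N = (N $ None $ None - (\<Sum>b\<in>UNIV. N $ None $ Some b * c b)) *
    det (\<chi> a b. N $ Some a $ Some b)"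
proof -
  \<comment> \<open>The column operation is Cramer's lemma: replacing column \<open>None\<close> by
    \<open>N *v v\<close> multiplies the determinant by \<open>v $ None\<close>, which is chosen to
    be 1.\<close>
  define v :: "'a ^ 'm option" where "v = (\<chi> k. case k of None \<Rightarrow> 1 | Some b \<Rightarrow> - c b)"
  define C where "C = (\<chi> i j. if j = None then (N *v v) $ i else N $ i $ j)"
  have Nv: "(N *v v) $ a = N $ a $ None - (\<Sum>b\<in>UNIV. N $ a $ Some b * c b)" for a
    by (simp add: matrix_vector_mult_def v_def UNIV_option_conv sum.reindex sum_negf)
  have "det N = v $ None * det N"
    by (simp add: v_def)
  also have "\<dots> = det C"
    unfolding C_def by (rule cramer_lemma[symmetric])
  also have "\<dots> = C $ None $ None * det (\<chi> a b. C $ Some a $ Some b)"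
    by (rule det_option_corner) (simp add: C_def Nv assms)
  finally show ?thesis
    by (simp add: C_def Nv)
qed

text \<open>Each summation index \<open>js m\<close> occurs in one row only. So in every Leibniz
  term the sum over all \<open>js\<close> factors, by distributivity, into one sum per row, which is
  an inner product.\<close>

lemma wedge_contraction:
  fixes u :: "'m::finite option \<Rightarrow> real ^ 'd" and w :: "'m \<Rightarrow> real ^ 'd"
  shows "(\<Sum>js\<in>UNIV. wedge u (case_option j js) * (\<Prod>m\<in>UNIV. w m $ js m)) =
    det (\<chi> a b. case a of None \<Rightarrow> u b $ j | Some m \<Rightarrow> w m \<bullet> u b)"
proof -
  let ?P = "{p. p permutes (UNIV :: 'm option set)}"
  have prod: "(\<Sum>js\<in>UNIV. \<Prod>m\<in>UNIV. u (p (Some m)) $ js m * w m $ js m) =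
      (\<Prod>m\<in>UNIV. w m \<bullet> u (p (Some m)))" for p :: "'m option \<Rightarrow> 'm option"
    using prod_sum_PiE[of "UNIV :: 'm set" "\<lambda>_. UNIV :: 'd set"
        "\<lambda>m k. u (p (Some m)) $ k * w m $ k"]
    by (simp add: inner_vec_def mult.commute)
  have "(\<Sum>js\<in>UNIV. wedge u (case_option j js) * (\<Prod>m\<in>UNIV. w m $ js m)) =
      (\<Sum>js\<in>UNIV. \<Sum>p\<in>?P. of_int (sign p) * u (p None) $ j *
        (\<Prod>m\<in>UNIV. u (p (Some m)) $ js m * w m $ js m))"
    by (simp add: wedge_def det_def sum_distrib_right UNIV_option_conv prod.reindex
        prod.distrib mult.assoc)
  also have "\<dots> = (\<Sum>p\<in>?P. of_int (sign p) * u (p None) $ j *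
      (\<Sum>js\<in>UNIV. \<Prod>m\<in>UNIV. u (p (Some m)) $ js m * w m $ js m))"
    by (subst sum.swap) (simp add: sum_distrib_left)
  also have "\<dots> = det (\<chi> a b. case a of None \<Rightarrow> u b $ j | Some m \<Rightarrow> w m \<bullet> u b)"
    by (simp add: prod det_def UNIV_option_conv prod.reindex mult.assoc)
  finally show ?thesis .
qed

section \<open>Gram matrix and oblique projector\<close>

lemma gram_nth: "gram it ib $ a $ b = ib a \<bullet> it b"
  by (simp add: gram_def matrix_matrix_mult_def transpose_def columns_matrix_def inner_vec_def)

lemma transpose_columns_matrix_mult_nth: "(transpose (columns_matrix ib) *v v) $ m = ib m \<bullet> v"
  by (simp add: matrix_vector_mult_def transpose_def columns_matrix_def inner_vec_def)

lemma columns_matrix_mult: "columns_matrix it *v c = (\<Sum>m\<in>UNIV. c $ m *\<^sub>R it m)"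
  by (simp add: vec_eq_iff matrix_vector_mult_def columns_matrix_def mult.commute)

lemma matrix_inv_inverse:
  fixes A :: "'a::semiring_1 ^ 'n ^ 'm"
  assumes "invertible A"
  shows "A ** matrix_inv A = mat 1" "matrix_inv A ** A = mat 1"
proof -
  have "A ** matrix_inv A = mat 1 \<and> matrix_inv A ** A = mat 1"
    unfolding matrix_inv_def by (rule someI_ex) (use assms in \<open>simp add: invertible_def\<close>)
  then show "A ** matrix_inv A = mat 1" "matrix_inv A ** A = mat 1"
    by auto
qed

lemma projector_mult:
  "projector it ib *v v = v - columns_matrix it *v
    (matrix_inv (gram it ib) *v (transpose (columns_matrix ib) *v v))"
  by (simp add: projector_def matrix_vector_mult_diff_rdistrib matrix_vector_mul_assoc
      matrix_mul_assoc)

text \<open>With G = B^T A, one has B^T P = B^T - G G^{-1} B^T = 0. This gives conservation of the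
  integrals by the projected method.\<close>

lemma transpose_columns_matrix_projector:
  assumes "invertible (gram it ib)"
  shows "transpose (columns_matrix ib) *v (projector it ib *v v) = 0"
proof -
  let ?w = "transpose (columns_matrix ib) *v v"
  have "transpose (columns_matrix ib) *v (projector it ib *v v) =
      ?w - (gram it ib ** matrix_inv (gram it ib)) *v ?w"
    by (simp add: projector_mult matrix_vector_mult_diff_distrib gram_def matrix_vector_mul_assoc
        matrix_mul_assoc)
  then show ?thesis
    by (simp add: matrix_inv_inverse[OF assms])
qed

lemma S_tensor_contraction:
  fixes it ib :: "'m::finite \<Rightarrow> real ^ 'd"
  assumes "det (gram it ib) \<noteq> 0"
  shows "(\<Sum>js\<in>UNIV. S_tensor ft it ib (case_option j js) * (\<Prod>m\<in>UNIV. ib m $ js m)) =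
    (projector it ib *v ft) $ j"
proof -
  \<comment> \<open>\<open>c\<close> solves G c = B^T \<open>ft\<close>, so it expresses the border
    column of \<open>N\<close> through the other columns; A c is what the projector subtracts from
    \<open>ft\<close>.\<close>
  define c where "c = matrix_inv (gram it ib) *v (transpose (columns_matrix ib) *v ft)"
  define N :: "real ^ 'm option ^ 'm option" where
    "N = (\<chi> a b. case a of None \<Rightarrow> case_option ft it b $ j | Some m \<Rightarrow> ib m \<bullet> case_option ft it b)"
  have "gram it ib *v c = transpose (columns_matrix ib) *v ft"
    using assms
    by (simp add: c_def matrix_vector_mul_assoc matrix_mul_assoc matrix_inv_inverse
        invertible_det_nz)
  then have "(\<Sum>b\<in>UNIV. (ib m \<bullet> it b) * c $ b) = ib m \<bullet> ft" for m
    by (simp add: vec_eq_iff transpose_columns_matrix_mult_nth)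
      (simp add: matrix_vector_mult_def gram_nth)
  then have "det N = (ft $ j - (\<Sum>b\<in>UNIV. it b $ j * c $ b)) * det (\<chi> a b. N $ Some a $ Some b)"
    by (subst det_option_bordered[where c = "($) c"]) (simp_all add: N_def gram_nth)
  also have "(\<chi> a b. N $ Some a $ Some b) = gram it ib"
    by (simp add: vec_eq_iff N_def gram_nth)
  also have "ft $ j - (\<Sum>b\<in>UNIV. it b $ j * c $ b) = (projector it ib *v ft) $ j"
    by (simp add: projector_mult columns_matrix_mult mult.commute flip: c_def)
  finally have "det N = (projector it ib *v ft) $ j * det (gram it ib)" .
  moreover have "(\<Sum>js\<in>UNIV. wedge (case_option ft it) (case_option j js) *
      (\<Prod>m\<in>UNIV. ib m $ js m)) = det N"
    by (simp add: wedge_contraction N_def)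
  \<comment> \<open>The prefactor of \<open>S_tensor\<close> cancels the Gram determinant.\<close>
  ultimately show ?thesis
    using assms by (simp add: S_tensor_def mult.assoc flip: sum_distrib_left sum_divide_distrib)
qed

section \<open>Equivalence of the methods\<close>

lemma DG_solution_iff_LP_proj_solution:
  "DG_solution ft it ib x h x' \<longleftrightarrow> LP_proj_solution ft it ib x h x'"
proof -
  have shift: "(x' = x + v) \<longleftrightarrow> (\<forall>j. x' $ j - x $ j = v $ j)" for v
    by (auto simp: vec_eq_iff algebra_simps)
  show ?thesis
    unfolding DG_solution_def LP_proj_solution_def invertible_det_nz shift
    \<comment> \<open>Both sides begin with the same nonvanishing determinant;
      \<open>conj_cong\<close> supplies it to the contraction formula in the second
      conjunct.\<close>
    by (intro conj_cong refl) (simp add: S_tensor_contraction)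
qed

text \<open>Injectivity turns a relation between family members into one on the set
  \<open>range u\<close>, with coefficients transported by \<open>inv u\<close>.\<close>

lemma lin_indep_familyD:
  fixes u :: "'m::finite \<Rightarrow> 'a::real_vector"
  assumes "lin_indep_family u" "(\<Sum>m\<in>UNIV. c m *\<^sub>R u m) = 0"
  shows "c m = 0"
proof -
  have inj: "inj u" and ind: "independent (range u)"
    using assms(1) by (auto simp: lin_indep_family_def)
  have "(\<Sum>v\<in>range u. c (inv u v) *\<^sub>R v) = 0"
    using assms(2) inj by (simp add: sum.reindex)
  then have "c (inv u (u m)) = 0"
    by (intro independentD[OF ind, where t = "range u" and u = "\<lambda>v. c (inv u v)"]) auto
  then show ?thesis
    using inj by simp
qed

text \<open>If B^T A c = 0, then A c lies in the span of \<open>it\<close> and is orthogonal to the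
  span of \<open>ib\<close>, so it vanishes by complementarity. Independence of \<open>it\<close>
  then gives c = 0, and a square matrix with trivial kernel is invertible.\<close>

lemma invertible_gram:
  fixes it ib :: "'m::finite \<Rightarrow> real ^ 'd"
  assumes "lin_indep_family it"
    and "complementary (span (range it)) (orthogonal_comp (span (range ib)))"
  shows "invertible (gram it ib)"
proof -
  have "c = 0" if c: "gram it ib *v c = 0" for c
  proof -
    let ?v = "columns_matrix it *v c"
    have "transpose (columns_matrix ib) *v ?v = 0"
      using c by (simp add: gram_def matrix_vector_mul_assoc)
    then have "ib m \<bullet> ?v = 0" for m
      by (metis transpose_columns_matrix_mult_nth zero_index)
    then have "orthogonal ?v y" if "y \<in> span (range ib)" for y
      by (intro orthogonal_to_span[OF that]) (auto simp: orthogonal_def inner_commute)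
    then have "?v \<in> orthogonal_comp (span (range ib))"
      by (auto simp: orthogonal_comp_def orthogonal_commute)
    moreover have "?v \<in> span (range it)"
      unfolding columns_matrix_mult by (intro span_sum span_scale span_base) auto
    ultimately have "?v = 0"
      using assms(2) by (auto simp: complementary_def)
    then show "c = 0"
      using lin_indep_familyD[OF assms(1)] by (simp add: columns_matrix_mult vec_eq_iff)
  qed
  then show ?thesis
    by (simp add: invertible_left_inverse matrix_left_invertible_ker)
qed

lemma LP_solution_iff_LP_proj_solution:
  fixes ib :: "'m::finite \<Rightarrow> real ^ 'd \<Rightarrow> real ^ 'd \<Rightarrow> real ^ 'd"
  assumes inv: "invertible (gram (\<lambda>m. it m x x' h) (\<lambda>m. ib m x x'))"
    and dg: "\<And>m. discrete_gradient (I m) (i m) (ib m)"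
  shows "(\<exists>lam. LP_solution ft it I x h x' lam) \<longleftrightarrow> LP_proj_solution ft it ib x h x'"
proof -
  let ?A = "columns_matrix (\<lambda>m. it m x x' h)"
  let ?BT = "transpose (columns_matrix (\<lambda>m. ib m x x'))"
  let ?G = "gram (\<lambda>m. it m x x' h) (\<lambda>m. ib m x x')"
  let ?P = "projector (\<lambda>m. it m x x' h) (\<lambda>m. ib m x x')"
  let ?f = "ft x x' h"
  have "I m x' - I m x = (?BT *v (x' - x)) $ m" for m
    using dg[of m] by (simp add: discrete_gradient_def transpose_columns_matrix_mult_nth)
  then have cons: "(\<forall>m. I m x' = I m x) \<longleftrightarrow> ?BT *v (x' - x) = 0"
    by (metis (no_types, lifting) eq_iff_diff_eq_0 vec_eq_iff zero_index)
  \<comment> \<open>The projected update is a multiplier update with lam = -h G^{-1} B^T f; this is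
    the witness in the converse direction.\<close>
  have P: "h *\<^sub>R (?P *v ?f) = h *\<^sub>R ?f + ?A *v (- h *\<^sub>R (matrix_inv ?G *v (?BT *v ?f)))"
    by (simp add: projector_mult matrix_vector_mult_scaleR scaleR_right_diff_distrib
        linear_neg[OF matrix_vector_mul_linear])
  show ?thesis
  proof
    assume "\<exists>lam. LP_solution ft it I x h x' lam"
    then obtain lam where x': "x' = x + h *\<^sub>R ?f + ?A *v lam" and "?BT *v (x' - x) = 0"
      unfolding LP_solution_def cons by blast
    moreover have "x' - x = h *\<^sub>R ?f + ?A *v lam"
      using x' by (simp add: algebra_simps)
    ultimately have "?BT *v (h *\<^sub>R ?f + ?A *v lam) = 0"
      by simp
    \<comment> \<open>Since B^T A = G, conservation fixes the multiplier uniquely, and it is the one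
      in \<open>P\<close>.\<close>
    then have "?G *v lam = - h *\<^sub>R (?BT *v ?f)"
      by (simp add: gram_def matrix_vector_right_distrib matrix_vector_mult_scaleR
          matrix_vector_mul_assoc eq_neg_iff_add_eq_0 add.commute)
    then have "matrix_inv ?G *v (?G *v lam) = - h *\<^sub>R (matrix_inv ?G *v (?BT *v ?f))"
      by (simp only: matrix_vector_mult_scaleR)
    then have "lam = - h *\<^sub>R (matrix_inv ?G *v (?BT *v ?f))"
      by (simp add: matrix_vector_mul_assoc matrix_inv_inverse[OF inv])
    then show "LP_proj_solution ft it ib x h x'"
      unfolding LP_proj_solution_def P using inv x' by (simp add: add.assoc)
  next
    assume "LP_proj_solution ft it ib x h x'"
    then have x': "x' = x + h *\<^sub>R (?P *v ?f)"
      by (simp add: LP_proj_solution_def)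
    then have "x' - x = h *\<^sub>R (?P *v ?f)"
      by (simp add: algebra_simps)
    then have "?BT *v (x' - x) = 0"
      by (simp add: matrix_vector_mult_scaleR transpose_columns_matrix_projector[OF inv])
    moreover have "x' = x + h *\<^sub>R ?f + ?A *v (- h *\<^sub>R (matrix_inv ?G *v (?BT *v ?f)))"
      using x' unfolding P by (simp only: add.assoc)
    ultimately show "\<exists>lam. LP_solution ft it I x h x' lam"
      unfolding LP_solution_def cons by blast
  qed
qed

theorem theorem15:
  fixes f :: "real ^ 'd \<Rightarrow> real ^ 'd"
    and I :: "'m::finite \<Rightarrow> real ^ 'd \<Rightarrow> real"
    and i :: "'m \<Rightarrow> real ^ 'd \<Rightarrow> real ^ 'd"
    and ft :: "real ^ 'd \<Rightarrow> real ^ 'd \<Rightarrow> real \<Rightarrow> real ^ 'd"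
    and it :: "'m \<Rightarrow> real ^ 'd \<Rightarrow> real ^ 'd \<Rightarrow> real \<Rightarrow> real ^ 'd"
    and ib :: "'m \<Rightarrow> real ^ 'd \<Rightarrow> real ^ 'd \<Rightarrow> real ^ 'd"
    and x :: "real ^ 'd" and h :: real
  assumes "locally_Lipschitz f"
    and "\<And>m. first_integral f (I m)"
    and "\<And>m y. GDERIV (I m) y :> i m y"
    and "consistent_approx f ft"
    and "\<And>m. consistent_approx (i m) (it m)"
    and "\<And>m. discrete_gradient (I m) (i m) (ib m)"
    and "h \<ge> 0"
    and unique_DG: "\<exists>!x'. DG_solution ft it ib x h x'"
    and unique_LP: "\<exists>!(x', lam). LP_solution ft it I x h x' lam"
    and independent: "\<And>x'. DG_solution ft it ib x h x' \<or> (\<exists>lam. LP_solution ft it I x h x' lam) \<or>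
          LP_proj_solution ft it ib x h x' \<Longrightarrow>
        lin_indep_family (\<lambda>m. it m x x' h) \<and> lin_indep_family (\<lambda>m. ib m x x')"
    and complementary: "\<And>x'. DG_solution ft it ib x h x' \<or> (\<exists>lam. LP_solution ft it I x h x' lam) \<or>
          LP_proj_solution ft it ib x h x' \<Longrightarrow>
        complementary (span (range (\<lambda>m. it m x x' h)))
          (orthogonal_comp (span (range (\<lambda>m. ib m x x'))))"
  shows "\<exists>x'. {y. DG_solution ft it ib x h y} = {x'} \<and>
              {y. \<exists>lam. LP_solution ft it I x h y lam} = {x'} \<and>
              {y. LP_proj_solution ft it ib x h y} = {x'}"
proof -
  obtain x' where x': "DG_solution ft it ib x h x'"
    and uniq: "\<And>y. DG_solution ft it ib x h y \<Longrightarrow> y = x'"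
    using unique_DG by blast
  have "(\<exists>lam. LP_solution ft it I x h y lam) \<longleftrightarrow> LP_proj_solution ft it ib x h y" for y
  \<comment> \<open>Independence and complementarity are assumed only at solutions. If
    \<open>y\<close> solves neither form, both sides are false; otherwise they make the Gram matrix
    at \<open>y\<close> invertible.\<close>
  proof (cases "(\<exists>lam. LP_solution ft it I x h y lam) \<or> LP_proj_solution ft it ib x h y")
    case True
    then have "invertible (gram (\<lambda>m. it m x y h) (\<lambda>m. ib m x y))"
      using independent[of y] complementary[of y] by (intro invertible_gram) blast+
    then show ?thesis
      by (rule LP_solution_iff_LP_proj_solution) fact
  qed auto
  then have "{y. \<exists>lam. LP_solution ft it I x h y lam} = {y. DG_solution ft it ib x h y}"
    and "{y. LP_proj_solution ft it ib x h y} = {y. DG_solution ft it ib x h y}"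
    by (simp_all add: DG_solution_iff_LP_proj_solution)
  moreover have "{y. DG_solution ft it ib x h y} = {x'}"
    using x' uniq by blast
  ultimately show ?thesis
    by blast
qed

end
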